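(* Let $C\subseteq\mathbb{N}$ be any cohesive set. Then there is a computable linear order $\mathcal{L}$ of order-type $\omega$ such that the cohesive power $\Pi_C\mathcal{L}$ is not elementarily equivalent (and hence not isomorphic) to $\omega+\zeta\eta$.
   Context: A set $C\subseteq\mathbb{N}$ is cohesive if it is infinite and for every c.e. set $W$, either $C\setminus W$ or $C\cap W$ is finite. Write $X\subseteq^* Y$ if $X\setminus Y$ is finite. For a computable linear order $\mathcal{L}=(L,\prec_{\mathcal{L}})$ (computable domain $L\subseteq\mathbb{N}$, computable order), the cohesive power $\Pi_C\mathcal{L}$ has as elements the classes $[\varphi]$ of partial computable $\varphi\colon\mathbb{N}\to L$ with $C\subseteq^*\mathrm{dom}(\varphi)$ under $\varphi=_C\psi$ iff $C\subseteq^*\{x:\varphi(x)\downarrow=\psi(x)\downarrow\}$, ordered by $[\varphi]\prec[\psi]$ iff $C\subseteq^*\{x:\varphi(x)\downarrow,\psi(x)\downarrow,\varphi(x)\prec_{\mathcal{L}}\psi(x)\}$. Elementary equivalence is in the language $\{\prec\}$ of linear orders. $\omega,\zeta,\eta$ are the order-types of $\mathbb{N},\mathbb{Z},\mathbb{Q}$; $\zeta\eta$ means $\eta$-many copies of $\zeta$ ordered lexicographically. *)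

theory Defs
  imports Main "HOL.Rat" "HOL-Library.Nat_Bijection"
begin

section \<open>Partial computable functions\<close>

text \<open>Primitive recursion for partial functions; arguments and parameters are packed into one
  number by Cantor's pairing function \<^const>\<open>prod_encode\<close>.\<close>

primrec prim_rec :: "(nat \<rightharpoonup> nat) \<Rightarrow> (nat \<rightharpoonup> nat) \<Rightarrow> nat \<Rightarrow> nat \<Rightarrow> nat option" where
  "prim_rec f g a 0 = f a"
| "prim_rec f g a (Suc k) =
     Option.bind (prim_rec f g a k) (\<lambda>r. g (prod_encode (a, prod_encode (k, r))))"

text \<open>Unbounded search: the least \<open>n\<close> with \<open>f (a, n) = 0\<close>, provided that \<open>f (a, m)\<close> is defined
  for all \<open>m < n\<close>; undefined otherwise.\<close>

definition mu_search :: "(nat \<rightharpoonup> nat) \<Rightarrow> nat \<Rightarrow> nat option" where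
  "mu_search f a =
     (if \<exists>n. f (prod_encode (a, n)) = Some 0 \<and> (\<forall>m<n. f (prod_encode (a, m)) \<noteq> None)
      then Some (LEAST n. f (prod_encode (a, n)) = Some 0) else None)"

text \<open>Kleene's partial recursive functions, presented as unary functions on numbers with
  the pairing function and its two projections among the initial operations, so that functions of
  several arguments are functions of coded tuples.\<close>

inductive partial_computable :: "(nat \<rightharpoonup> nat) \<Rightarrow> bool" where
  zero: "partial_computable (\<lambda>_. Some 0)"
| succ: "partial_computable (\<lambda>n. Some (Suc n))"
| left: "partial_computable (\<lambda>n. Some (fst (prod_decode n)))"
| right: "partial_computable (\<lambda>n. Some (snd (prod_decode n)))"
| pair: "partial_computable f \<Longrightarrow> partial_computable g \<Longrightarrow>
    partial_computable
      (\<lambda>n. Option.bind (f n) (\<lambda>a. Option.bind (g n) (\<lambda>b. Some (prod_encode (a, b)))))"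
| comp: "partial_computable f \<Longrightarrow> partial_computable g \<Longrightarrow> partial_computable (g \<circ>\<^sub>m f)"
| prec: "partial_computable f \<Longrightarrow> partial_computable g \<Longrightarrow>
    partial_computable (\<lambda>n. prim_rec f g (fst (prod_decode n)) (snd (prod_decode n)))"
| mu: "partial_computable f \<Longrightarrow> partial_computable (mu_search f)"

definition ce_set :: "nat set \<Rightarrow> bool" where
  "ce_set W \<longleftrightarrow> (\<exists>f. partial_computable f \<and> W = dom f)"

definition computable_set :: "nat set \<Rightarrow> bool" where
  "computable_set A \<longleftrightarrow> partial_computable (\<lambda>x. Some (if x \<in> A then 1 else 0))"

section \<open>Cohesive sets\<close>

definition almost_subset :: "'a set \<Rightarrow> 'a set \<Rightarrow> bool" (infix "\<subseteq>\<^sup>*" 50) where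
  "X \<subseteq>\<^sup>* Y \<longleftrightarrow> finite (X - Y)"

definition cohesive :: "nat set \<Rightarrow> bool" where
  "cohesive C \<longleftrightarrow> infinite C \<and> (\<forall>W. ce_set W \<longrightarrow> finite (C - W) \<or> finite (C \<inter> W))"

section \<open>Linear orders\<close>

text \<open>A structure for the language of linear orders: a domain and the (strict) order relation.\<close>

type_synonym 'a ordstruct = "'a set \<times> 'a rel"

definition is_linear_order :: "'a ordstruct \<Rightarrow> bool" where
  "is_linear_order = (\<lambda>(A, r). r \<subseteq> A \<times> A \<and> strict_linear_order_on A r)"

definition computable_linear_order :: "nat ordstruct \<Rightarrow> bool" where
  "computable_linear_order = (\<lambda>(L, r).
     is_linear_order (L, r) \<and> computable_set L \<and> computable_set (prod_encode ` r))"

definition isomorphic :: "'a ordstruct \<Rightarrow> 'b ordstruct \<Rightarrow> bool" where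
  "isomorphic = (\<lambda>(A, r) (B, s).
     \<exists>f. bij_betw f A B \<and> (\<forall>x\<in>A. \<forall>y\<in>A. (x, y) \<in> r \<longleftrightarrow> (f x, f y) \<in> s))"

definition order_sum :: "'a ordstruct \<Rightarrow> 'b ordstruct \<Rightarrow> ('a + 'b) ordstruct" where
  "order_sum = (\<lambda>(A, r) (B, s).
     (A <+> B,
      {(Inl x, Inl y) | x y. (x, y) \<in> r} \<union> {(Inr x, Inr y) | x y. (x, y) \<in> s}
        \<union> {(Inl x, Inr y) | x y. x \<in> A \<and> y \<in> B}))"

text \<open>\<open>B\<close>-many copies of \<open>A\<close>, ordered lexicographically; written \<open>A B\<close> in the usual notation
  for products of order-types, with the index of the copy being the dominant component.\<close>

definition order_prod :: "'a ordstruct \<Rightarrow> 'b ordstruct \<Rightarrow> ('b \<times> 'a) ordstruct" where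
  "order_prod = (\<lambda>(A, r) (B, s). (B \<times> A, (s <*lex*> r) \<inter> (B \<times> A) \<times> (B \<times> A)))"

definition omega :: "nat ordstruct" where
  "omega = (UNIV, {(x, y). x < y})"

definition zeta :: "int ordstruct" where
  "zeta = (UNIV, {(x, y). x < y})"

definition eta :: "rat ordstruct" where
  "eta = (UNIV, {(x, y). x < y})"

section \<open>Cohesive powers\<close>

definition cohesive_funs :: "nat set \<Rightarrow> nat ordstruct \<Rightarrow> (nat \<rightharpoonup> nat) set" where
  "cohesive_funs C \<L> = {\<phi>. partial_computable \<phi> \<and> ran \<phi> \<subseteq> fst \<L> \<and> C \<subseteq>\<^sup>* dom \<phi>}"

definition cohesive_eq :: "nat set \<Rightarrow> nat ordstruct \<Rightarrow> (nat \<rightharpoonup> nat) rel" where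
  "cohesive_eq C \<L> = {(\<phi>, \<psi>). \<phi> \<in> cohesive_funs C \<L> \<and> \<psi> \<in> cohesive_funs C \<L> \<and>
     C \<subseteq>\<^sup>* {x. \<exists>a. \<phi> x = Some a \<and> \<psi> x = Some a}}"

definition cohesive_class :: "nat set \<Rightarrow> nat ordstruct \<Rightarrow> (nat \<rightharpoonup> nat) \<Rightarrow> (nat \<rightharpoonup> nat) set" where
  "cohesive_class C \<L> \<phi> = cohesive_eq C \<L> `` {\<phi>}"

definition cohesive_power :: "nat set \<Rightarrow> nat ordstruct \<Rightarrow> (nat \<rightharpoonup> nat) set ordstruct" where
  "cohesive_power C \<L> =
     (cohesive_funs C \<L> // cohesive_eq C \<L>,
      {(cohesive_class C \<L> \<phi>, cohesive_class C \<L> \<psi>) | \<phi> \<psi>.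
         \<phi> \<in> cohesive_funs C \<L> \<and> \<psi> \<in> cohesive_funs C \<L> \<and>
         C \<subseteq>\<^sup>* {x. \<exists>a b. \<phi> x = Some a \<and> \<psi> x = Some b \<and> (a, b) \<in> snd \<L>}})"

lemma almost_subset_mono: "X \<subseteq>\<^sup>* Y \<Longrightarrow> Y \<subseteq> Z \<Longrightarrow> X \<subseteq>\<^sup>* Z"
  unfolding almost_subset_def by (meson Diff_mono finite_subset order_refl)

lemma almost_subset_Int: "X \<subseteq>\<^sup>* Y \<Longrightarrow> X \<subseteq>\<^sup>* Z \<Longrightarrow> X \<subseteq>\<^sup>* Y \<inter> Z"
  unfolding almost_subset_def by (simp add: Diff_Int)

lemma equiv_cohesive_eq: "equiv (cohesive_funs C \<L>) (cohesive_eq C \<L>)"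
proof (rule equivI)
  show "cohesive_eq C \<L> \<subseteq> cohesive_funs C \<L> \<times> cohesive_funs C \<L>"
    by (auto simp: cohesive_eq_def)
  have "dom \<phi> = {x. \<exists>a. \<phi> x = Some a}" for \<phi> :: "nat \<rightharpoonup> nat"
    by auto
  then show "refl_on (cohesive_funs C \<L>) (cohesive_eq C \<L>)"
    by (auto simp: refl_on_def cohesive_eq_def cohesive_funs_def)
  show "sym (cohesive_eq C \<L>)"
    by (auto simp: sym_def cohesive_eq_def elim: almost_subset_mono)
  show "trans (cohesive_eq C \<L>)"
  proof (rule transI)
    fix \<phi> \<psi> \<chi>
    assume *: "(\<phi>, \<psi>) \<in> cohesive_eq C \<L>" "(\<psi>, \<chi>) \<in> cohesive_eq C \<L>"
    then have "C \<subseteq>\<^sup>* {x. \<exists>a. \<phi> x = Some a \<and> \<psi> x = Some a}"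
      "C \<subseteq>\<^sup>* {x. \<exists>a. \<psi> x = Some a \<and> \<chi> x = Some a}"
      by (auto simp: cohesive_eq_def)
    from almost_subset_Int[OF this] have "C \<subseteq>\<^sup>* {x. \<exists>a. \<phi> x = Some a \<and> \<chi> x = Some a}"
      by (rule almost_subset_mono) auto
    with * show "(\<phi>, \<chi>) \<in> cohesive_eq C \<L>"
      by (auto simp: cohesive_eq_def)
  qed
qed

text \<open>The order on classes does not depend on the representatives.\<close>

lemma cohesive_power_less_iff:
  assumes "\<phi> \<in> cohesive_funs C \<L>" "\<psi> \<in> cohesive_funs C \<L>"
  shows "(cohesive_class C \<L> \<phi>, cohesive_class C \<L> \<psi>) \<in> snd (cohesive_power C \<L>) \<longleftrightarrow>
    C \<subseteq>\<^sup>* {x. \<exists>a b. \<phi> x = Some a \<and> \<psi> x = Some b \<and> (a, b) \<in> snd \<L>}"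
    (is "?lhs \<longleftrightarrow> ?rhs")
proof
  assume ?lhs
  then obtain \<phi>' \<psi>' where
    *: "cohesive_class C \<L> \<phi> = cohesive_class C \<L> \<phi>'" "cohesive_class C \<L> \<psi> = cohesive_class C \<L> \<psi>'"
    "\<phi>' \<in> cohesive_funs C \<L>" "\<psi>' \<in> cohesive_funs C \<L>"
    "C \<subseteq>\<^sup>* {x. \<exists>a b. \<phi>' x = Some a \<and> \<psi>' x = Some b \<and> (a, b) \<in> snd \<L>}"
    by (auto simp: cohesive_power_def)
  then have "(\<phi>, \<phi>') \<in> cohesive_eq C \<L>" "(\<psi>, \<psi>') \<in> cohesive_eq C \<L>"
    using assms equiv_cohesive_eq[of C \<L>] unfolding cohesive_class_def
    by (metis eq_equiv_class_iff)+
  then have "C \<subseteq>\<^sup>* {x. \<exists>a. \<phi> x = Some a \<and> \<phi>' x = Some a}"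
    "C \<subseteq>\<^sup>* {x. \<exists>a. \<psi> x = Some a \<and> \<psi>' x = Some a}"
    by (auto simp: cohesive_eq_def)
  from almost_subset_Int[OF almost_subset_Int[OF this] *(5)] show ?rhs
    by (rule almost_subset_mono) auto
qed (use assms in \<open>auto simp: cohesive_power_def\<close>)

section \<open>First-order logic in the language of linear orders\<close>

datatype fo_formula =
  Less nat nat
| Equal nat nat
| Neg fo_formula
| Conj fo_formula fo_formula
| Forall nat fo_formula

primrec free_vars :: "fo_formula \<Rightarrow> nat set" where
  "free_vars (Less i j) = {i, j}"
| "free_vars (Equal i j) = {i, j}"
| "free_vars (Neg p) = free_vars p"
| "free_vars (Conj p q) = free_vars p \<union> free_vars q"
| "free_vars (Forall i p) = free_vars p - {i}"

definition sentence :: "fo_formula \<Rightarrow> bool" where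
  "sentence p \<longleftrightarrow> free_vars p = {}"

primrec sat :: "'a ordstruct \<Rightarrow> (nat \<Rightarrow> 'a) \<Rightarrow> fo_formula \<Rightarrow> bool" where
  "sat M v (Less i j) \<longleftrightarrow> (v i, v j) \<in> snd M"
| "sat M v (Equal i j) \<longleftrightarrow> v i = v j"
| "sat M v (Neg p) \<longleftrightarrow> \<not> sat M v p"
| "sat M v (Conj p q) \<longleftrightarrow> sat M v p \<and> sat M v q"
| "sat M v (Forall i p) \<longleftrightarrow> (\<forall>a\<in>fst M. sat M (v(i := a)) p)"

lemma sat_cong: "(\<And>i. i \<in> free_vars p \<Longrightarrow> v i = w i) \<Longrightarrow> sat M v p \<longleftrightarrow> sat M w p"
proof (induction p arbitrary: v w)
  case (Neg p)
  from Neg.IH[of v w] Neg.prems show ?case by simp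
next
  case (Conj p q)
  from Conj.IH(1)[of v w] Conj.IH(2)[of v w] Conj.prems show ?case by simp
next
  case (Forall i p)
  have "sat M (v(i := a)) p \<longleftrightarrow> sat M (w(i := a)) p" for a
    by (rule Forall.IH) (use Forall.prems in auto)
  then show ?case by simp
qed auto

text \<open>The truth value of a sentence does not depend on the assignment (see \<open>sat_cong\<close>).\<close>

definition models :: "'a ordstruct \<Rightarrow> fo_formula \<Rightarrow> bool" where
  "models M p \<longleftrightarrow> (\<forall>v. sat M v p)"

lemma models_iff_sat: "sentence p \<Longrightarrow> models M p \<longleftrightarrow> sat M v p"
  unfolding models_def sentence_def using sat_cong by blast

definition elementarily_equivalent :: "'a ordstruct \<Rightarrow> 'b ordstruct \<Rightarrow> bool" where
  "elementarily_equivalent M N \<longleftrightarrow> (\<forall>p. sentence p \<longrightarrow> (models M p \<longleftrightarrow> models N p))"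

end

theory Submission imports Defs "HOL-Library.Infinite_Set" begin

text \<open>In \<open>\<omega> + \<zeta>\<eta>\<close> every element has an immediate successor. The order built here consists of
  numbers \<open>(n, 0)\<close> in their usual order, and as soon as the \<open>e\<close>-th partial computable function
  \<open>\<phi>\<close> is seen to converge at \<open>n \<ge> e\<close>, one filler is put right after \<open>(n - 1, 0)\<close>. Each gap
  receives at most \<open>n + 1\<close> fillers, so the order has type \<open>\<omega>\<close>. The filler that answers \<open>\<phi> n\<close> has a
  code exceeding \<open>\<phi> n\<close>, so ordering the fillers of a gap by decreasing code puts it below \<open>\<phi> n\<close>
  whenever \<open>\<phi> n\<close> lies above \<open>(n - 1, 0)\<close>. As the filler is computable from \<open>n\<close>, no \<open>[\<phi>]\<close> is the
  immediate successor of the class of \<open>n \<mapsto> (n - 1, 0)\<close> in the cohesive power.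

  The required enumeration of the partial computable functions takes as computation traces finite
  sets of claims ``program \<open>e\<close> maps \<open>x\<close> to \<open>y\<close>'', each justified by other claims of the set. A
  justification refers to subprograms or to smaller recursion arguments, hence is never circular.\<close>

section \<open>Total computable functions and decidable predicates\<close>

abbreviation pfst :: "nat \<Rightarrow> nat" where
  "pfst n \<equiv> fst (prod_decode n)"

abbreviation psnd :: "nat \<Rightarrow> nat" where
  "psnd n \<equiv> snd (prod_decode n)"

definition total_computable :: "(nat \<Rightarrow> nat) \<Rightarrow> bool" where
  "total_computable f \<longleftrightarrow> partial_computable (\<lambda>x. Some (f x))"

definition decidable :: "(nat \<Rightarrow> bool) \<Rightarrow> bool" where
  "decidable P \<longleftrightarrow> total_computable (\<lambda>x. of_bool (P x))"

lemma computable_set_iff_decidable: "computable_set A \<longleftrightarrow> decidable (\<lambda>x. x \<in> A)"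
  unfolding computable_set_def decidable_def total_computable_def of_bool_def ..

lemma total_computable_comp:
  assumes "total_computable f" "total_computable g"
  shows "total_computable (\<lambda>x. g (f x))"
  using partial_computable.comp[OF assms[unfolded total_computable_def]]
  by (simp add: total_computable_def map_comp_def)

lemma total_computable_pair:
  assumes "total_computable f" "total_computable g"
  shows "total_computable (\<lambda>x. prod_encode (f x, g x))"
  using partial_computable.pair[OF assms[unfolded total_computable_def]]
  by (simp add: total_computable_def)

lemma total_computable_pfst: "total_computable f \<Longrightarrow> total_computable (\<lambda>x. pfst (f x))"
  by (rule total_computable_comp[where g = pfst])
    (simp_all add: total_computable_def partial_computable.left)

lemma total_computable_psnd: "total_computable f \<Longrightarrow> total_computable (\<lambda>x. psnd (f x))"
  by (rule total_computable_comp[where g = psnd])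
    (simp_all add: total_computable_def partial_computable.right)

lemma total_computable_Suc: "total_computable f \<Longrightarrow> total_computable (\<lambda>x. Suc (f x))"
  by (rule total_computable_comp[where g = Suc])
    (simp_all add: total_computable_def partial_computable.succ)

text \<open>The initial functions contain no identity; it is recovered by pairing the two
  projections.\<close>

lemma total_computable_id: "total_computable (\<lambda>x. x)"
proof -
  have "total_computable (\<lambda>x. prod_encode (pfst x, psnd x))"
    by (intro total_computable_pair)
      (simp_all add: total_computable_def partial_computable.left partial_computable.right)
  then show ?thesis by simp
qed

lemma total_computable_const: "total_computable (\<lambda>_. k)"
proof (induction k)
  case 0
  show ?case by (simp add: total_computable_def partial_computable.zero)
qed (rule total_computable_Suc)

text \<open>The source of all arithmetic below. The step function is required to be computable on
  the packed triple of parameter, counter and previous value.\<close>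

lemma total_computable_rec_nat:
  assumes "total_computable f"
    and "total_computable (\<lambda>p. g (pfst p) (pfst (psnd p)) (psnd (psnd p)))"
    and "total_computable n"
  shows "total_computable (\<lambda>x. rec_nat (f x) (g x) (n x))"
proof -
  let ?f = "\<lambda>x. Some (f x)" and ?g = "\<lambda>p. Some (g (pfst p) (pfst (psnd p)) (psnd (psnd p)))"
  have "prim_rec ?f ?g a k = Some (rec_nat (f a) (g a) k)" for a k
    by (induction k) simp_all
  with partial_computable.prec[of ?f ?g] assms(1,2)
  have "total_computable (\<lambda>p. rec_nat (f (pfst p)) (g (pfst p)) (psnd p))"
    by (simp add: total_computable_def)
  from total_computable_comp[OF total_computable_pair[OF total_computable_id assms(3)] this]
  show ?thesis by simp
qed

lemma decidable_comp: "decidable P \<Longrightarrow> total_computable f \<Longrightarrow> decidable (\<lambda>x. P (f x))"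
  unfolding decidable_def by (rule total_computable_comp)

lemma decidable_pair_comp:
  assumes "decidable (\<lambda>p. P (pfst p) (psnd p))" "total_computable f" "total_computable g"
  shows "decidable (\<lambda>x. P (f x) (g x))"
  using decidable_comp[OF assms(1) total_computable_pair[OF assms(2,3)]] by simp

text \<open>The truth value serves as recursion length: length 0 yields \<open>g x\<close>, length 1
  yields \<open>f x\<close>.\<close>

lemma total_computable_if:
  assumes "decidable P" "total_computable f" "total_computable g"
  shows "total_computable (\<lambda>x. if P x then f x else g x)"
proof -
  have "total_computable (\<lambda>p. f (pfst p))"
    by (intro total_computable_comp[OF _ assms(2)] total_computable_pfst total_computable_id)
  then have "total_computable (\<lambda>x. rec_nat (g x) (\<lambda>_ _. f x) (of_bool (P x)))"
    using assms by (intro total_computable_rec_nat) (simp_all add: decidable_def)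
  also have "(\<lambda>x. rec_nat (g x) (\<lambda>_ _. f x) (of_bool (P x))) = (\<lambda>x. if P x then f x else g x)"
    by auto
  finally show ?thesis .
qed

lemma decidable_const: "decidable (\<lambda>_. b)"
  unfolding decidable_def by (rule total_computable_const)

lemma decidable_if:
  assumes "decidable P" "decidable Q" "decidable R"
  shows "decidable (\<lambda>x. if P x then Q x else R x)"
  using total_computable_if[OF assms[unfolded decidable_def[of Q] decidable_def[of R]]]
  by (simp add: decidable_def if_distrib)

lemma decidable_not: "decidable P \<Longrightarrow> decidable (\<lambda>x. \<not> P x)"
  using decidable_if[of P "\<lambda>_. False" "\<lambda>_. True"] by (simp add: decidable_const if_bool_eq_disj)

lemma decidable_conj: "decidable P \<Longrightarrow> decidable Q \<Longrightarrow> decidable (\<lambda>x. P x \<and> Q x)"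
  using decidable_if[of P Q "\<lambda>_. False"] by (simp add: decidable_const if_bool_eq_disj)

lemma decidable_disj: "decidable P \<Longrightarrow> decidable Q \<Longrightarrow> decidable (\<lambda>x. P x \<or> Q x)"
  using decidable_not[OF decidable_conj[OF decidable_not decidable_not]] by simp

lemma decidable_imp: "decidable P \<Longrightarrow> decidable Q \<Longrightarrow> decidable (\<lambda>x. P x \<longrightarrow> Q x)"
  using decidable_disj[OF decidable_not] by simp

section \<open>Arithmetic and bounded quantifiers\<close>

lemma total_computable_diff:
  assumes "total_computable f" "total_computable g"
  shows "total_computable (\<lambda>x. f x - g x)"
proof -
  \<comment> \<open>A recursion whose step returns its counter is the predecessor; iterating it
    gives truncated subtraction.\<close>
  have pred: "total_computable (\<lambda>x. rec_nat 0 (\<lambda>k _. k) x)"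
    by (intro total_computable_rec_nat total_computable_const total_computable_pfst
        total_computable_psnd total_computable_id)
  have "rec_nat 0 (\<lambda>k _. k) x = x - 1" for x :: nat
    by (cases x) simp_all
  with pred have pred: "total_computable (\<lambda>x. x - 1)"
    by simp
  have "total_computable (\<lambda>x. rec_nat (f x) (\<lambda>_ r. r - 1) (g x))"
    by (intro total_computable_rec_nat assms total_computable_comp[OF _ pred]
        total_computable_psnd total_computable_id)
  moreover have "rec_nat a (\<lambda>_ r. r - 1) b = a - b" for a b :: nat
    by (induction b) simp_all
  ultimately show ?thesis by simp
qed

lemma decidable_less:
  assumes "total_computable f" "total_computable g"
  shows "decidable (\<lambda>x. f x < g x)"
proof -
  have "total_computable (\<lambda>x. rec_nat 0 (\<lambda>_ _. 1) (g x - f x))"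
    by (intro total_computable_rec_nat total_computable_const total_computable_diff assms)
  moreover have "rec_nat 0 (\<lambda>_ _. 1) n = (of_bool (0 < n) :: nat)" for n :: nat
    by (cases n) simp_all
  ultimately show ?thesis by (simp only: decidable_def zero_less_diff)
qed

lemma decidable_le:
  assumes "total_computable f" "total_computable g"
  shows "decidable (\<lambda>x. f x \<le> g x)"
  using decidable_not[OF decidable_less[OF assms(2,1)]] by (simp only: not_less)

lemma decidable_eq:
  assumes "total_computable f" "total_computable g"
  shows "decidable (\<lambda>x. f x = g x)"
  using decidable_conj[OF decidable_le[OF assms] decidable_le[OF assms(2,1)]]
  by (simp only: order.eq_iff[symmetric])

lemma decidable_bex:
  assumes "decidable (\<lambda>p. P (pfst p) (psnd p))" "total_computable b"
  shows "decidable (\<lambda>x. \<exists>m<b x. P x m)"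
proof -
  have "total_computable (\<lambda>x. rec_nat 0 (\<lambda>k r. if P x k then 1 else r) (b x))"
    by (intro total_computable_rec_nat total_computable_if decidable_pair_comp[OF assms(1)]
        total_computable_const total_computable_pfst total_computable_psnd total_computable_id assms(2))
  moreover have "rec_nat 0 (\<lambda>k r. if P x k then 1 else r) n = (of_bool (\<exists>m<n. P x m) :: nat)" for x n
    by (induction n) (auto simp: less_Suc_eq)
  ultimately show ?thesis by (simp add: decidable_def)
qed

lemma decidable_ball:
  assumes "decidable (\<lambda>p. P (pfst p) (psnd p))" "total_computable b"
  shows "decidable (\<lambda>x. \<forall>m<b x. P x m)"
  using decidable_not[OF decidable_bex[OF decidable_not[OF assms(1)] assms(2)]] by simp

lemmas computable_intros =
  total_computable_id total_computable_const total_computable_Suc total_computable_diff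
  total_computable_pair total_computable_pfst total_computable_psnd
  decidable_const decidable_not decidable_conj decidable_disj decidable_imp
  decidable_less decidable_le decidable_eq decidable_bex decidable_ball

section \<open>Finite sets coded by numbers, and unbounded search\<close>

text \<open>Membership of \<open>n\<close> is the parity of the quotient by \<open>2 ^ n\<close>,
  which arises by halving \<open>n\<close> times; parity and halving are themselves
  recursions.\<close>

lemma decidable_set_decode:
  assumes "total_computable f" "total_computable g"
  shows "decidable (\<lambda>x. f x \<in> set_decode (g x))"
proof -
  have "total_computable (\<lambda>n. rec_nat 0 (\<lambda>_ r. 1 - r) n)"
    by (intro total_computable_rec_nat computable_intros)
  moreover have "rec_nat 0 (\<lambda>_ r. 1 - r) n = n mod 2" for n :: nat
    by (induction n) (auto simp: mod_Suc)
  ultimately have parity: "total_computable (\<lambda>n. n mod 2)"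
    by simp
  have "total_computable (\<lambda>n. rec_nat 0 (\<lambda>k r. if k mod 2 = 1 then Suc r else r) n)"
    by (intro total_computable_rec_nat total_computable_if computable_intros
        total_computable_comp[OF _ parity])
  moreover have "rec_nat 0 (\<lambda>k r. if k mod 2 = 1 then Suc r else r) n = n div 2" for n :: nat
    by (induction n) (simp_all, presburger)
  ultimately have half: "total_computable (\<lambda>n. n div 2)"
    by simp
  have "total_computable (\<lambda>x. rec_nat (g x) (\<lambda>_ r. r div 2) (f x))"
    by (intro total_computable_rec_nat computable_intros assms
        total_computable_comp[OF _ half])
  moreover have "rec_nat s (\<lambda>_ r. r div 2) n = s div 2 ^ n" for s n :: nat
    by (induction n) (simp_all add: power_Suc2 div_mult2_eq del: power_Suc)
  ultimately have "total_computable (\<lambda>x. g x div 2 ^ f x)"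
    by simp
  from decidable_eq[OF total_computable_comp[OF this parity] total_computable_const[of 1]]
  show ?thesis by (simp add: set_decode_def odd_iff_mod_2_eq_one)
qed

text \<open>Makes quantifiers over the members of a coded trace bounded, hence decidable.\<close>

lemma set_decode_less: "n \<in> set_decode S \<Longrightarrow> n < S"
proof -
  assume "n \<in> set_decode S"
  then have "2 ^ n \<le> S"
    by (auto simp: set_decode_def intro: ccontr)
  then show "n < S"
    by (rule less_le_trans[OF less_exp])
qed

lemma partial_computable_Least:
  assumes "decidable (\<lambda>p. P (pfst p) (psnd p))"
  shows "partial_computable (\<lambda>x. if \<exists>n. P x n then Some (LEAST n. P x n) else None)"
proof -
  \<comment> \<open>\<open>mu_search\<close> looks for a zero, so truth is coded by 0 here. Totality
    of \<open>?f\<close> makes the definedness condition on smaller arguments automatic.\<close>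
  let ?f = "\<lambda>p. if P (pfst p) (psnd p) then 0 else 1"
  have "partial_computable (mu_search (\<lambda>p. Some (?f p)))"
    using total_computable_if[OF assms total_computable_const total_computable_const]
    by (intro partial_computable.mu) (simp add: total_computable_def)
  also have "mu_search (\<lambda>p. Some (?f p)) = (\<lambda>x. if \<exists>n. P x n then Some (LEAST n. P x n) else None)"
    by (auto simp: mu_search_def fun_eq_iff)
  finally show ?thesis .
qed

section \<open>An enumeration of the partial computable functions\<close>

abbreviation code :: "nat \<Rightarrow> nat \<Rightarrow> nat \<Rightarrow> nat" where
  "code t i j \<equiv> prod_encode (t, prod_encode (i, j))"

text \<open>A number \<^term>\<open>code e x y\<close> in \<open>A\<close> stands for the claim that the program \<open>e\<close> maps \<open>x\<close> to \<open>y\<close>.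
  A program is itself of the form \<^term>\<open>code t i j\<close>, where the tag \<open>t\<close> numbers the clauses of
  \<^const>\<open>partial_computable\<close> and \<open>i\<close>, \<open>j\<close> are the subprograms.\<close>

definition justified :: "nat set \<Rightarrow> nat \<Rightarrow> nat \<Rightarrow> nat \<Rightarrow> bool" where
  "justified A e x y \<longleftrightarrow> (let t = pfst e; i = pfst (psnd e); j = psnd (psnd e) in
     t = 0 \<and> y = 0 \<or>
     t = 1 \<and> y = Suc x \<or>
     t = 2 \<and> y = pfst x \<or>
     t = 3 \<and> y = psnd x \<or>
     t = 4 \<and> code i x (pfst y) \<in> A \<and> code j x (psnd y) \<in> A \<or>
     t = 5 \<and> (\<exists>z. code i x z \<in> A \<and> code j z y \<in> A) \<or>
     t = 6 \<and> psnd x = 0 \<and> code i (pfst x) y \<in> A \<or>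
     t = 6 \<and> psnd x \<noteq> 0 \<and> (\<exists>r. code e (prod_encode (pfst x, psnd x - 1)) r \<in> A \<and>
                                  code j (code (pfst x) (psnd x - 1) r) y \<in> A) \<or>
     t = 7 \<and> code i (prod_encode (x, y)) 0 \<in> A \<and>
       (\<forall>m<y. \<exists>z. code i (prod_encode (x, m)) (Suc z) \<in> A))"

definition closed_trace :: "nat set \<Rightarrow> bool" where
  "closed_trace A \<longleftrightarrow> (\<forall>e x y. code e x y \<in> A \<longrightarrow> justified A e x y)"

definition derivable :: "nat set" where
  "derivable = \<Union>{A. finite A \<and> closed_trace A}"

text \<open>The set of claims occurs only positively in \<open>justified\<close>.\<close>

lemma justified_mono: "justified A e x y \<Longrightarrow> A \<subseteq> B \<Longrightarrow> justified B e x y"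
  unfolding justified_def Let_def by (elim disjE) (simp_all, blast+)

text \<open>Every clause cites at most two claims, except minimisation, which cites one for each
  \<open>m < y\<close> and one for \<open>y\<close>.\<close>

lemma justified_finite_support:
  assumes "justified A e x y"
  shows "\<exists>B\<subseteq>A. finite B \<and> justified B e x y"
proof -
  define i where "i = pfst (psnd e)"
  define j where "j = psnd (psnd e)"
  have support: ?thesis if "B \<subseteq> A" "finite B" "justified B e x y" for B
    using that by blast
  from assms consider
      (basic) "pfst e = 0 \<and> y = 0 \<or> pfst e = 1 \<and> y = Suc x \<or>
        pfst e = 2 \<and> y = pfst x \<or> pfst e = 3 \<and> y = psnd x"
    | (pair) "pfst e = 4" "code i x (pfst y) \<in> A" "code j x (psnd y) \<in> A"
    | (comp) z where "pfst e = 5" "code i x z \<in> A" "code j z y \<in> A"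
    | (prec_0) "pfst e = 6" "psnd x = 0" "code i (pfst x) y \<in> A"
    | (prec_Suc) r where "pfst e = 6" "psnd x \<noteq> 0"
        "code e (prod_encode (pfst x, psnd x - 1)) r \<in> A"
        "code j (code (pfst x) (psnd x - 1) r) y \<in> A"
    | (mu) "pfst e = 7" "code i (prod_encode (x, y)) 0 \<in> A"
        "\<forall>m<y. \<exists>z. code i (prod_encode (x, m)) (Suc z) \<in> A"
    unfolding justified_def Let_def i_def j_def by (elim disjE conjE exE; blast)
  then show ?thesis
  proof cases
    case basic
    then show ?thesis by (intro support[of "{}"]) (auto simp: justified_def)
  next
    case pair
    then show ?thesis
      by (intro support[of "{code i x (pfst y), code j x (psnd y)}"])
        (auto simp: justified_def Let_def i_def j_def)
  next
    case comp
    then show ?thesis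
      by (intro support[of "{code i x z, code j z y}"])
        (auto simp: justified_def Let_def i_def j_def)
  next
    case prec_0
    then show ?thesis
      by (intro support[of "{code i (pfst x) y}"]) (auto simp: justified_def Let_def i_def j_def)
  next
    case prec_Suc
    then show ?thesis
      by (intro support[of "{code e (prod_encode (pfst x, psnd x - 1)) r,
            code j (code (pfst x) (psnd x - 1) r) y}"])
        (auto simp: justified_def Let_def i_def j_def)
  next
    case mu
    from mu(3) obtain z where z: "\<And>m. m < y \<Longrightarrow> code i (prod_encode (x, m)) (Suc (z m)) \<in> A"
      by metis
    show ?thesis
      by (rule support[of "insert (code i (prod_encode (x, y)) 0)
            ((\<lambda>m. code i (prod_encode (x, m)) (Suc (z m))) ` {..<y})"])
        (use mu z in \<open>auto simp: justified_def Let_def i_def j_def\<close>)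
  qed
qed

lemma closed_trace_Union: "(\<And>A. A \<in> \<A> \<Longrightarrow> closed_trace A) \<Longrightarrow> closed_trace (\<Union>\<A>)"
  unfolding closed_trace_def by (meson Union_iff Union_upper justified_mono)

text \<open>The fixed-point equation for derivability. A union of closed traces is closed, which
  gives one direction. Conversely, a justification cites finitely many claims; the union of finite
  traces for them stays closed when the new claim is added.\<close>

lemma derivable_iff: "code e x y \<in> derivable \<longleftrightarrow> justified derivable e x y"
proof
  have "closed_trace derivable"
    unfolding derivable_def by (rule closed_trace_Union) simp
  then show "code e x y \<in> derivable \<Longrightarrow> justified derivable e x y"
    by (simp add: closed_trace_def)
next
  assume "justified derivable e x y"
  from justified_finite_support[OF this]
  obtain B where B: "B \<subseteq> derivable" "finite B" "justified B e x y"
    by auto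
  have "\<forall>b\<in>B. \<exists>A. finite A \<and> closed_trace A \<and> b \<in> A"
    using B(1) unfolding derivable_def by blast
  from bchoice[OF this]
  obtain A where A: "\<forall>b\<in>B. finite (A b) \<and> closed_trace (A b) \<and> b \<in> A b"
    by (elim exE)
  define D where "D = \<Union>(A ` B)"
  have "B \<subseteq> D"
    using A unfolding D_def by blast
  have "finite D"
    using A B(2) unfolding D_def by blast
  have "closed_trace D"
    unfolding D_def using A by (intro closed_trace_Union) blast
  have "closed_trace (insert (code e x y) D)"
    unfolding closed_trace_def
  proof (intro allI impI)
    fix e' x' y'
    assume "code e' x' y' \<in> insert (code e x y) D"
    then consider "code e' x' y' = code e x y" | "code e' x' y' \<in> D"
      by blast
    then have "justified D e' x' y'"
    proof cases
      case 1
      then have "justified B e' x' y'"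
        using B(3) by (simp only: prod_encode_eq prod.inject)
      then show ?thesis
        using \<open>B \<subseteq> D\<close> by (rule justified_mono)
    next
      case 2
      then show ?thesis
        using \<open>closed_trace D\<close> by (simp add: closed_trace_def)
    qed
    then show "justified (insert (code e x y) D) e' x' y'"
      by (rule justified_mono) blast
  qed
  with \<open>finite D\<close> show "code e x y \<in> derivable"
    unfolding derivable_def by (intro UnionI[of "insert (code e x y) D"]) simp_all
qed

section \<open>Every partial computable function has a program\<close>

lemma derivable_basic:
  "code (code 0 i j) x y \<in> derivable \<longleftrightarrow> y = 0"
  "code (code (Suc 0) i j) x y \<in> derivable \<longleftrightarrow> y = Suc x"
  "code (code 2 i j) x y \<in> derivable \<longleftrightarrow> y = pfst x"
  "code (code 3 i j) x y \<in> derivable \<longleftrightarrow> y = psnd x"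
  by (subst derivable_iff, simp add: justified_def)+

lemma derivable_pair:
  "code (code 4 i j) x y \<in> derivable \<longleftrightarrow>
    code i x (pfst y) \<in> derivable \<and> code j x (psnd y) \<in> derivable"
  by (subst derivable_iff) (simp add: justified_def)

lemma derivable_comp:
  "code (code 5 i j) x y \<in> derivable \<longleftrightarrow>
    (\<exists>z. code i x z \<in> derivable \<and> code j z y \<in> derivable)"
  by (subst derivable_iff) (simp add: justified_def)

lemma derivable_prec:
  "code (code 6 i j) (prod_encode (a, 0)) y \<in> derivable \<longleftrightarrow> code i a y \<in> derivable"
  "code (code 6 i j) (prod_encode (a, Suc k)) y \<in> derivable \<longleftrightarrow>
    (\<exists>r. code (code 6 i j) (prod_encode (a, k)) r \<in> derivable \<and> code j (code a k r) y \<in> derivable)"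
  by (subst derivable_iff, simp add: justified_def)+

lemma derivable_mu:
  "code (code 7 i j) x y \<in> derivable \<longleftrightarrow> code i (prod_encode (x, y)) 0 \<in> derivable \<and>
    (\<forall>m<y. \<exists>z. code i (prod_encode (x, m)) (Suc z) \<in> derivable)"
  by (subst derivable_iff) (simp add: justified_def)

text \<open>Brings minimisation into the shape of its trace clause. Values before the least zero are
  nonzero by minimality, and defined because the least zero is at most the \<open>n\<close> given by
  \<open>mu_search_def\<close>.\<close>

lemma mu_search_eq_Some_iff:
  "mu_search f x = Some y \<longleftrightarrow>
    f (prod_encode (x, y)) = Some 0 \<and> (\<forall>m<y. \<exists>z. f (prod_encode (x, m)) = Some (Suc z))"
  (is "_ \<longleftrightarrow> ?zero y \<and> ?pos y")
proof
  assume "mu_search f x = Some y"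
  then obtain n where n: "?zero n" "\<forall>m<n. f (prod_encode (x, m)) \<noteq> None" and y: "y = (LEAST n. ?zero n)"
    by (auto simp: mu_search_def split: if_splits)
  have "?zero y"
    unfolding y using n(1) by (rule LeastI)
  moreover have "y \<le> n"
    unfolding y using n(1) by (rule Least_le)
  moreover have "\<not> ?zero m" if "m < y" for m
    using that unfolding y by (rule not_less_Least)
  ultimately show "?zero y \<and> ?pos y"
    using n(2) by (metis not0_implies_Suc option.exhaust order.strict_trans2)
next
  assume y: "?zero y \<and> ?pos y"
  then have "(LEAST n. ?zero n) = y"
    by (intro Least_equality) (auto simp: not_less[symmetric])
  moreover have "\<forall>m<y. f (prod_encode (x, m)) \<noteq> None"
    using y by auto
  ultimately show "mu_search f x = Some y"
    using y by (auto simp: mu_search_def)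
qed

text \<open>Each closure clause matches the fixed-point equation for its tag. Since the claims about
  \<open>e\<close> form exactly the graph of \<open>f\<close>, a trace can never assert a wrong
  value.\<close>

lemma partial_computable_has_code:
  assumes "partial_computable f"
  shows "\<exists>e. \<forall>x y. code e x y \<in> derivable \<longleftrightarrow> f x = Some y"
  using assms
proof (induction rule: partial_computable.induct)
  case zero
  show ?case by (rule exI[of _ "code 0 0 0"]) (auto simp: derivable_basic)
next
  case succ
  show ?case by (rule exI[of _ "code (Suc 0) 0 0"]) (auto simp: derivable_basic)
next
  case left
  show ?case by (rule exI[of _ "code 2 0 0"]) (auto simp: derivable_basic)
next
  case right
  show ?case by (rule exI[of _ "code 3 0 0"]) (auto simp: derivable_basic)
next
  case (pair f g)
  then obtain i j where
    "\<And>x y. code i x y \<in> derivable \<longleftrightarrow> f x = Some y"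
    "\<And>x y. code j x y \<in> derivable \<longleftrightarrow> g x = Some y"
    by blast
  then show ?case
    by (intro exI[of _ "code 4 i j"]) (auto simp: derivable_pair bind_eq_Some_conv)
next
  case (comp f g)
  then obtain i j where
    "\<And>x y. code i x y \<in> derivable \<longleftrightarrow> f x = Some y"
    "\<And>x y. code j x y \<in> derivable \<longleftrightarrow> g x = Some y"
    by blast
  then show ?case
    by (intro exI[of _ "code 5 i j"]) (auto simp: derivable_comp map_comp_Some_iff)
next
  case (prec f g)
  then obtain i j where ij:
    "\<And>x y. code i x y \<in> derivable \<longleftrightarrow> f x = Some y"
    "\<And>x y. code j x y \<in> derivable \<longleftrightarrow> g x = Some y"
    by blast
  \<comment> \<open>The value stays arbitrary in the induction because the step passes through the
    previous value \<open>r\<close>.\<close>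
  have "code (code 6 i j) (prod_encode (a, k)) y \<in> derivable \<longleftrightarrow> prim_rec f g a k = Some y" for a k y
    by (induction k arbitrary: y) (simp_all add: derivable_prec ij bind_eq_Some_conv)
  then have "code (code 6 i j) x y \<in> derivable \<longleftrightarrow> prim_rec f g (pfst x) (psnd x) = Some y" for x y
    by (metis prod.collapse prod_decode_inverse)
  then show ?case by blast
next
  case (mu f)
  then obtain i where "\<And>x y. code i x y \<in> derivable \<longleftrightarrow> f x = Some y"
    by blast
  then show ?case
    by (intro exI[of _ "code 7 i 0"]) (simp add: derivable_mu mu_search_eq_Some_iff)
qed

section \<open>Decidability of closed traces\<close>

lemma code_in_set_decode_less: "code e x y \<in> set_decode S \<Longrightarrow> y < S"
  using le_prod_encode_2[of y x] le_prod_encode_2[of "prod_encode (x, y)" e]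
    set_decode_less[of "code e x y" S]
  by linarith

lemma closed_trace_set_decode:
  "closed_trace (set_decode S) \<longleftrightarrow>
    (\<forall>c<S. c \<in> set_decode S \<longrightarrow> justified (set_decode S) (pfst c) (pfst (psnd c)) (psnd (psnd c)))"
  (is "_ \<longleftrightarrow> ?R")
proof
  assume ?R
  show "closed_trace (set_decode S)"
    unfolding closed_trace_def
  proof (intro allI impI)
    fix e x y
    assume "code e x y \<in> set_decode S"
    with \<open>?R\<close> set_decode_less[OF this] show "justified (set_decode S) e x y"
      by force
  qed
qed (simp add: closed_trace_def)

lemma decidable_closed_trace:
  assumes "total_computable f"
  shows "decidable (\<lambda>x. closed_trace (set_decode (f x)))"
proof -
  \<comment> \<open>The first equation bounds the intermediate values of composition and recursion,
    the second the nonzero values in the minimisation clause.\<close>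
  have bound: "(\<exists>z. code i x z \<in> set_decode S \<and> Q z) \<longleftrightarrow> (\<exists>z<S. code i x z \<in> set_decode S \<and> Q z)"
    "(\<exists>z. code i x (Suc z) \<in> set_decode S) \<longleftrightarrow> (\<exists>z<S. code i x (Suc z) \<in> set_decode S)"
    for i x S Q
    using code_in_set_decode_less Suc_lessD by blast+
  have "decidable (\<lambda>S. closed_trace (set_decode S))"
    unfolding closed_trace_set_decode justified_def Let_def bound
    by (intro computable_intros decidable_set_decode)
  from decidable_comp[OF this assms] show ?thesis .
qed

section \<open>The order\<close>

text \<open>A witness \<open>w\<close> is a pair of the value of program \<open>e\<close> at \<open>n\<close> and a trace proving it. The
  restriction to \<open>e \<le> n\<close> keeps the number of fillers in each block finite.\<close>

definition witness :: "nat \<Rightarrow> nat \<Rightarrow> nat \<Rightarrow> bool" where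
  "witness e n w \<longleftrightarrow>
     e \<le> n \<and> closed_trace (set_decode (psnd w)) \<and> code e n (pfst w) \<in> set_decode (psnd w)"

text \<open>Leastness leaves each program at most one filler per block.\<close>

definition least_witness :: "nat \<Rightarrow> nat \<Rightarrow> nat \<Rightarrow> bool" where
  "least_witness e n w \<longleftrightarrow> witness e n w \<and> (\<forall>v<w. \<not> witness e n v)"

text \<open>The number \<open>(n, c)\<close> belongs to block \<open>n\<close>. For \<open>c = 0\<close> it is the last element of the block;
  for \<open>c = (e, w) + 1\<close> it is a filler that keeps the value of program \<open>e\<close> at \<open>n\<close> from being
  the immediate successor of the last element \<open>(n - 1, 0)\<close> of the previous block.\<close>

definition filled_dom :: "nat set" where
  "filled_dom =
     {x. psnd x = 0 \<or> least_witness (pfst (psnd x - 1)) (pfst x) (psnd (psnd x - 1))}"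

definition filled_less :: "nat rel" where
  "filled_less = {(x, y). x \<in> filled_dom \<and> y \<in> filled_dom \<and>
     (pfst x < pfst y \<or> pfst x = pfst y \<and> psnd y < psnd x)}"

lemma decidable_witness:
  assumes "total_computable f" "total_computable g" "total_computable h"
  shows "decidable (\<lambda>x. witness (f x) (g x) (h x))"
  unfolding witness_def
  by (intro computable_intros decidable_closed_trace decidable_set_decode assms)

lemma decidable_filled_dom:
  assumes "total_computable f"
  shows "decidable (\<lambda>x. f x \<in> filled_dom)"
proof -
  have "decidable (\<lambda>x. x \<in> filled_dom)"
    unfolding filled_dom_def least_witness_def mem_Collect_eq
    by (intro computable_intros decidable_witness)
  from decidable_comp[OF this assms] show ?thesis .
qed

lemma is_linear_order_filled: "is_linear_order (filled_dom, filled_less)"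
proof -
  have "x = y" if "pfst x = pfst y" "psnd x = psnd y" for x y
    using that by (metis prod.collapse prod_decode_inverse)
  then show ?thesis
    unfolding is_linear_order_def strict_linear_order_on_def filled_less_def
    by (auto simp: trans_def irrefl_def total_on_def) (metis linorder_neqE_nat)+
qed

lemma computable_filled: "computable_linear_order (filled_dom, filled_less)"
proof -
  have "x \<in> prod_encode ` filled_less \<longleftrightarrow> (pfst x, psnd x) \<in> filled_less" for x
    by (metis imageE imageI prod.collapse prod_decode_inverse prod_encode_inverse)
  then have "decidable (\<lambda>x. x \<in> prod_encode ` filled_less)"
    unfolding filled_less_def
    by (simp only: mem_Collect_eq prod.case) (intro computable_intros decidable_filled_dom)
  then show ?thesis
    using is_linear_order_filled decidable_filled_dom[OF total_computable_id]
    by (simp add: computable_linear_order_def computable_set_iff_decidable)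
qed

section \<open>The order-type of the constructed order\<close>

lemma finite_filled_block: "finite {x \<in> filled_dom. pfst x = n}"
proof (rule finite_subset)
  \<comment> \<open>If \<open>e\<close> has no witness at \<open>n\<close>, the \<open>LEAST\<close>
    is arbitrary; this is harmless, as only an inclusion is claimed.\<close>
  let ?filler = "\<lambda>e. prod_encode (n, Suc (prod_encode (e, LEAST w. witness e n w)))"
  show "{x \<in> filled_dom. pfst x = n} \<subseteq> insert (prod_encode (n, 0)) (?filler ` {..n})"
  proof
    fix x
    assume "x \<in> {x \<in> filled_dom. pfst x = n}"
    then have dom: "x \<in> filled_dom" and n: "pfst x = n"
      by auto
    then have x: "x = prod_encode (n, psnd x)"
      by (metis prod.collapse prod_decode_inverse)
    show "x \<in> insert (prod_encode (n, 0)) (?filler ` {..n})"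
    proof (cases "psnd x")
      case (Suc c)
      then have c: "least_witness (pfst c) n (psnd c)"
        using dom n by (simp add: filled_dom_def)
      then have "psnd c = (LEAST w. witness (pfst c) n w)"
        unfolding least_witness_def by (metis LeastI Least_le le_less)
      then have "x = ?filler (pfst c)"
        using x Suc by (metis prod.collapse prod_decode_inverse)
      moreover have "pfst c \<le> n"
        using c by (simp add: least_witness_def witness_def)
      ultimately show ?thesis by blast
    qed (use x in auto)
  qed
qed simp

text \<open>Counting predecessors embeds the order into the natural numbers.\<close>

lemma isomorphic_omega_if_finite_initial_segments:
  assumes lin: "is_linear_order (A, r)" and inf: "infinite A"
    and fin: "\<And>x. x \<in> A \<Longrightarrow> finite {y. (y, x) \<in> r}"
  shows "isomorphic (A, r) omega"
proof -
  define rank where "rank x = card {y. (y, x) \<in> r}" for x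
  have tr: "trans r" and irr: "irrefl r" and tot: "total_on A r" and sub: "r \<subseteq> A \<times> A"
    using lin by (auto simp: is_linear_order_def strict_linear_order_on_def)
  have mono: "rank x < rank y" if "(x, y) \<in> r" for x y
    unfolding rank_def
  proof (rule psubset_card_mono)
    show "finite {z. (z, y) \<in> r}"
      using that sub fin by blast
    show "{z. (z, x) \<in> r} \<subset> {z. (z, y) \<in> r}"
      using that tr irr by (auto dest: transD simp: irrefl_def)
  qed
  have rank_less: "rank x < rank y \<longleftrightarrow> (x, y) \<in> r" if "x \<in> A" "y \<in> A" for x y
    using mono that tot unfolding total_on_def by (metis less_asym' less_irrefl)
  have inj: "inj_on rank A"
    using tot mono unfolding inj_on_def total_on_def by (metis less_irrefl)
  \<comment> \<open>Instead of showing that \<open>rank\<close> is onto, its infinite range is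
    renumbered increasingly.\<close>
  define E where "E = Infinite_Set.enumerate (rank ` A)"
  have infR: "infinite (rank ` A)"
    using inf inj by (simp add: finite_image_iff)
  then have bij: "bij_betw E UNIV (rank ` A)" and E_less: "E m < E n \<longleftrightarrow> m < n" for m n
    unfolding E_def by (simp_all add: bij_enumerate enumerate_mono_iff)
  have "bij_betw (the_inv E \<circ> rank) A UNIV"
    using inj bij by (intro bij_betw_trans[of rank A "rank ` A"] bij_betw_the_inv_into)
      (simp_all add: bij_betw_def)
  moreover have "(x, y) \<in> r \<longleftrightarrow> the_inv E (rank x) < the_inv E (rank y)" if "x \<in> A" "y \<in> A" for x y
    using that rank_less bij E_less
    by (metis bij_betw_imp_inj_on bij_betw_imp_surj_on f_the_inv_into_f imageI)
  ultimately show ?thesis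
    by (auto simp: isomorphic_def omega_def intro!: exI[of _ "the_inv E \<circ> rank"])
qed

lemma last_in_filled_dom: "prod_encode (n, 0) \<in> filled_dom"
  by (simp add: filled_dom_def)

lemma isomorphic_filled_omega: "isomorphic (filled_dom, filled_less) omega"
proof (rule isomorphic_omega_if_finite_initial_segments[OF is_linear_order_filled])
  have "inj (\<lambda>n. prod_encode (n, 0))"
    by (simp add: inj_def)
  then show "infinite filled_dom"
    by (rule infinite_super[rotated, OF range_inj_infinite]) (auto simp: last_in_filled_dom)
  have "{y. (y, x) \<in> filled_less} \<subseteq> (\<Union>n\<le>pfst x. {y \<in> filled_dom. pfst y = n})" for x
    by (auto simp: filled_less_def)
  then show "finite {y. (y, x) \<in> filled_less}" for x
    by (rule finite_subset) (simp add: finite_filled_block)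
qed

section \<open>Immediate successors\<close>

text \<open>The first-order property that separates the two orders.\<close>

definition has_successors :: "'a ordstruct \<Rightarrow> bool" where
  "has_successors M \<longleftrightarrow>
     (\<forall>x\<in>fst M. \<exists>y\<in>fst M. (x, y) \<in> snd M \<and> (\<forall>z\<in>fst M. \<not> ((x, z) \<in> snd M \<and> (z, y) \<in> snd M)))"

lemma has_successors_if_elementarily_equivalent:
  assumes "elementarily_equivalent M N" "has_successors N"
  shows "has_successors M"
proof -
  \<comment> \<open>The existential quantifier over variable 1 is written as a negated universal
    one.\<close>
  let ?p = "Forall 0 (Neg (Forall 1 (Neg (Conj (Less 0 1)
    (Forall 2 (Neg (Conj (Less 0 2) (Less 2 1))))))))"
  have "sentence ?p"
    by (auto simp: sentence_def)
  with assms(1) have "models M ?p \<longleftrightarrow> models N ?p"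
    by (simp add: elementarily_equivalent_def)
  moreover have "models M ?p \<longleftrightarrow> has_successors M" "models N ?p \<longleftrightarrow> has_successors N"
    by (auto simp: models_def has_successors_def)
  ultimately show ?thesis
    using assms(2) by simp
qed

lemma has_successors_if_isomorphic:
  assumes "isomorphic M N" "has_successors N"
  shows "has_successors M"
proof -
  obtain f where f: "bij_betw f (fst M) (fst N)"
    "\<And>x y. x \<in> fst M \<Longrightarrow> y \<in> fst M \<Longrightarrow> (x, y) \<in> snd M \<longleftrightarrow> (f x, f y) \<in> snd N"
    using assms(1) by (auto simp: isomorphic_def split: prod.splits)
  have "fst N = f ` fst M"
    using f(1) by (simp add: bij_betw_def)
  with assms(2) show ?thesis
    by (simp add: has_successors_def f(2))
qed

text \<open>The successor of \<open>(q, i)\<close> is \<open>(q, i + 1)\<close>: the index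
  \<open>q\<close> of the copy dominates, so the density of \<eta> puts nothing between points of
  one copy.\<close>

lemma has_successors_omega_zeta_eta: "has_successors (order_sum omega (order_prod zeta eta))"
proof -
  let ?M = "order_sum omega (order_prod zeta eta)"
  have M: "fst ?M = UNIV"
    "(Inl m, Inl n) \<in> snd ?M \<longleftrightarrow> m < n" "(Inl m, Inr p) \<in> snd ?M" "(Inr p, Inl m) \<notin> snd ?M"
    "(Inr (q, i), Inr (s, j)) \<in> snd ?M \<longleftrightarrow> q < s \<or> q = s \<and> i < j" for m n p q s i j
    by (auto simp: order_sum_def order_prod_def omega_def zeta_def eta_def)
  have "\<exists>y. (x, y) \<in> snd ?M \<and> (\<forall>z. \<not> ((x, z) \<in> snd ?M \<and> (z, y) \<in> snd ?M))" for x
  proof (cases x)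
    case (Inl n)
    have "\<not> ((x, z) \<in> snd ?M \<and> (z, Inl (Suc n)) \<in> snd ?M)" for z
      by (cases z) (auto simp: M Inl)
    then show ?thesis
      by (intro exI[of _ "Inl (Suc n)"]) (simp add: M Inl)
  next
    case (Inr p)
    obtain q i where p: "p = (q, i)"
      by (cases p)
    have "\<not> ((x, z) \<in> snd ?M \<and> (z, Inr (q, i + 1)) \<in> snd ?M)" for z
    proof (cases z)
      case [simp]: (Inr p')
      then show ?thesis
        by (cases p') (auto simp: M \<open>x = Inr p\<close> p)
    qed (auto simp: M Inr)
    then show ?thesis
      by (intro exI[of _ "Inr (q, i + 1)"]) (simp add: M Inr p)
  qed
  then show ?thesis
    by (simp add: has_successors_def M(1))
qed

section \<open>The missing successor in the cohesive power\<close>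

lemma witness_exists:
  assumes "code e n v \<in> derivable" "e \<le> n"
  shows "\<exists>w. witness e n w"
proof -
  obtain A where "finite A" "closed_trace A" "code e n v \<in> A"
    using assms(1) unfolding derivable_def by blast
  then have "witness e n (prod_encode (v, set_encode A))"
    using assms(2) by (simp add: witness_def)
  then show ?thesis ..
qed

text \<open>Soundness: the value stored in a witness is one the program really takes.\<close>

lemma witness_derivable: "witness e n w \<Longrightarrow> code e n (pfst w) \<in> derivable"
  unfolding derivable_def
  by (rule UnionI[of "set_decode (psnd w)"]) (simp_all add: witness_def)

text \<open>Inequalities of classes only concern almost all \<open>n\<close> in \<open>C\<close>, so
  the finitely many \<open>n\<close> \<le> \<open>e\<close> may be ignored.\<close>

lemma not_has_successors_cohesive_power:
  "\<not> has_successors (cohesive_power C (filled_dom, filled_less))"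
proof
  let ?L = "(filled_dom, filled_less)"
  let ?F = "cohesive_funs C ?L"
  assume succ: "has_successors (cohesive_power C ?L)"
  have class_in: "cohesive_class C ?L \<phi> \<in> fst (cohesive_power C ?L)" if "\<phi> \<in> ?F" for \<phi>
    using that by (simp add: cohesive_power_def cohesive_class_def quotientI)
  \<comment> \<open>At \<open>n = 0\<close> truncated subtraction gives \<open>(0, 0)\<close> again;
    this argument is discarded later.\<close>
  define base where "base n = Some (prod_encode (n - 1, 0))" for n
  have "partial_computable base"
    unfolding base_def total_computable_def[symmetric] by (intro computable_intros)
  moreover have "dom base = UNIV" "ran base \<subseteq> filled_dom"
    by (auto simp: base_def ran_def last_in_filled_dom)
  ultimately have base: "base \<in> ?F"
    by (simp add: cohesive_funs_def almost_subset_def)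
  obtain \<phi> where \<phi>: "\<phi> \<in> ?F"
    and less: "(cohesive_class C ?L base, cohesive_class C ?L \<phi>) \<in> snd (cohesive_power C ?L)"
    and gap: "\<And>\<theta>. \<theta> \<in> ?F \<Longrightarrow>
      \<not> ((cohesive_class C ?L base, cohesive_class C ?L \<theta>) \<in> snd (cohesive_power C ?L) \<and>
         (cohesive_class C ?L \<theta>, cohesive_class C ?L \<phi>) \<in> snd (cohesive_power C ?L))"
  proof -
    obtain Y where "Y \<in> fst (cohesive_power C ?L)"
      "(cohesive_class C ?L base, Y) \<in> snd (cohesive_power C ?L)"
      "\<And>Z. Z \<in> fst (cohesive_power C ?L) \<Longrightarrow>
        \<not> ((cohesive_class C ?L base, Z) \<in> snd (cohesive_power C ?L) \<and>
           (Z, Y) \<in> snd (cohesive_power C ?L))"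
      using succ class_in[OF base] unfolding has_successors_def by blast
    moreover from this(1) obtain \<phi> where "\<phi> \<in> ?F" "Y = cohesive_class C ?L \<phi>"
      by (auto simp: cohesive_power_def cohesive_class_def elim: quotientE)
    ultimately show thesis
      using class_in by (intro that[of \<phi>]) auto
  qed
  have "partial_computable \<phi>"
    using \<phi> by (simp add: cohesive_funs_def)
  then obtain e where e: "\<And>x y. code e x y \<in> derivable \<longleftrightarrow> \<phi> x = Some y"
    using partial_computable_has_code by blast
  \<comment> \<open>Because \<open>witness\<close> demands \<open>e\<close> \<le> \<open>n\<close>,
    the search also diverges at every \<open>n < e\<close>.\<close>
  define search where
    "search n = (if \<exists>w. witness e n w then Some (LEAST w. witness e n w) else None)" for n
  define filler where "filler n w = prod_encode (n, Suc (prod_encode (e, w)))" for n w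
  define \<theta> where "\<theta> n = map_option (filler n) (search n)" for n
  have "partial_computable search"
    unfolding search_def by (intro partial_computable_Least decidable_witness computable_intros)
  \<comment> \<open>The filler depends on \<open>n\<close> as well as on the witness found, so the
    search is paired with the identity.\<close>
  from partial_computable.pair[OF total_computable_id[unfolded total_computable_def] this]
  have "partial_computable (\<lambda>n. Option.bind (search n) (\<lambda>w. Some (prod_encode (n, w))))"
    by simp
  moreover have "total_computable (\<lambda>p. filler (pfst p) (psnd p))"
    unfolding filler_def by (intro computable_intros)
  then have "partial_computable (\<lambda>p. Some (filler (pfst p) (psnd p)))"
    by (simp add: total_computable_def)
  ultimately have "partial_computable ((\<lambda>p. Some (filler (pfst p) (psnd p))) \<circ>\<^sub>m
      (\<lambda>n. Option.bind (search n) (\<lambda>w. Some (prod_encode (n, w)))))"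
    by (rule partial_computable.comp)
  also have "\<dots> = \<theta>"
  proof
    show "((\<lambda>p. Some (filler (pfst p) (psnd p))) \<circ>\<^sub>m
        (\<lambda>n. Option.bind (search n) (\<lambda>w. Some (prod_encode (n, w))))) n = \<theta> n" for n
      by (cases "search n") (simp_all add: \<theta>_def map_comp_def)
  qed
  finally have "partial_computable \<theta>" .
  have search_Some: "least_witness e n w" if "search n = Some w" for n w
    using that unfolding search_def least_witness_def
    by (auto split: if_splits intro: LeastI dest: not_less_Least)
  have filler_in: "filler n w \<in> filled_dom" if "search n = Some w" for n w
    using search_Some[OF that] by (simp add: filler_def filled_dom_def)
  have "\<exists>w. search n = Some w" if "\<phi> n = Some v" "e \<le> n" for n v
    using witness_exists[of e n v] that by (simp add: e search_def)
  then have \<theta>_dom: "\<exists>w. search n = Some w \<and> \<theta> n = Some (filler n w)"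
    if "\<phi> n = Some v" "e \<le> n" for n v
    using that by (fastforce simp: \<theta>_def)
  have "C \<subseteq>\<^sup>* dom \<phi>"
    using \<phi> by (simp add: cohesive_funs_def)
  \<comment> \<open>Starting at \<open>Suc e\<close> secures both \<open>e\<close> \<le>
    \<open>n\<close> and \<open>n > 0\<close>, so that \<open>n - 1\<close> really is the previous
    block.\<close>
  moreover have late: "C \<subseteq>\<^sup>* {Suc e..}"
    unfolding almost_subset_def by (rule finite_subset[of _ "{..e}"]) auto
  ultimately have "C \<subseteq>\<^sup>* dom \<phi> \<inter> {Suc e..}"
    by (rule almost_subset_Int)
  then have "C \<subseteq>\<^sup>* dom \<theta>"
    by (rule almost_subset_mono) (use \<theta>_dom in fastforce)
  moreover have "ran \<theta> \<subseteq> filled_dom"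
    using filler_in by (auto simp: \<theta>_def ran_def)
  ultimately have \<theta>: "\<theta> \<in> ?F"
    using \<open>partial_computable \<theta>\<close> by (simp add: cohesive_funs_def)
  have between: "\<exists>c. \<theta> n = Some c \<and> (prod_encode (n - 1, 0), c) \<in> filled_less \<and> (c, v) \<in> filled_less"
    if n: "Suc e \<le> n" and v: "\<phi> n = Some v" and less: "(prod_encode (n - 1, 0), v) \<in> filled_less"
    for n v
  proof -
    obtain w where w: "search n = Some w" "\<theta> n = Some (filler n w)"
      using \<theta>_dom[OF v] n by auto
    have "code e n (pfst w) \<in> derivable"
      using search_Some[OF w(1)] by (auto simp: least_witness_def intro: witness_derivable)
    then have "pfst w = v"
      using v by (simp add: e)
    \<comment> \<open>Pairing dominates its components: \<open>psnd v\<close> \<le> \<open>v\<close>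
      \<le> \<open>w\<close> \<le> \<open>prod_encode (e, w)\<close>. So the filler has the larger
      second component and lies below \<open>v\<close> if they share a block.\<close>
    then have "v \<le> w"
      by (metis le_prod_encode_1 prod.collapse prod_decode_inverse)
    then have "psnd v < Suc (prod_encode (e, w))"
      using le_prod_encode_2[of "psnd v" "pfst v"] le_prod_encode_2[of w e] by simp
    \<comment> \<open>As \<open>(n - 1, 0)\<close> is last in its block, \<open>v\<close> lies in
      block \<open>n\<close> or later; in a later block it is above the filler anyway.\<close>
    moreover have "n \<le> pfst v" "v \<in> filled_dom"
      using less n by (auto simp: filled_less_def)
    ultimately show ?thesis
      using w filler_in[OF w(1)] n
      by (auto simp: filled_less_def last_in_filled_dom filler_def)
  qed
  have "C \<subseteq>\<^sup>* {n. \<exists>a b. base n = Some a \<and> \<phi> n = Some b \<and> (a, b) \<in> filled_less}"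
    using less by (simp add: cohesive_power_less_iff[OF base \<phi>])
  \<comment> \<open>This one set of arguments supports both class inequalities that contradict
    \<open>gap\<close>.\<close>
  from almost_subset_Int[OF late this] have *: "C \<subseteq>\<^sup>* {n. \<exists>v c. \<phi> n = Some v \<and> \<theta> n = Some c \<and>
      (prod_encode (n - 1, 0), c) \<in> filled_less \<and> (c, v) \<in> filled_less}"
    by (rule almost_subset_mono) (use between in \<open>fastforce simp: base_def\<close>)
  have "(cohesive_class C ?L base, cohesive_class C ?L \<theta>) \<in> snd (cohesive_power C ?L)"
    unfolding cohesive_power_less_iff[OF base \<theta>]
    by (rule almost_subset_mono[OF *]) (auto simp: base_def)
  moreover have "(cohesive_class C ?L \<theta>, cohesive_class C ?L \<phi>) \<in> snd (cohesive_power C ?L)"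
    unfolding cohesive_power_less_iff[OF \<theta> \<phi>] by (rule almost_subset_mono[OF *]) auto
  ultimately show False
    using gap[OF \<theta>] by blast
qed

theorem theorem4p9:
  fixes C :: "nat set"
  assumes "cohesive C"
  shows "\<exists>\<L> :: nat ordstruct.
    computable_linear_order \<L> \<and> isomorphic \<L> omega \<and>
    \<not> elementarily_equivalent (cohesive_power C \<L>) (order_sum omega (order_prod zeta eta)) \<and>
    \<not> isomorphic (cohesive_power C \<L>) (order_sum omega (order_prod zeta eta))"
  using computable_filled isomorphic_filled_omega not_has_successors_cohesive_power
    has_successors_omega_zeta_eta has_successors_if_elementarily_equivalent
    has_successors_if_isomorphic
  by blast

end
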